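(* For every nonnegative integer $n$: let $GG_2(n)$ denote the number of partitions of $n$ with all parts at least $3$ in which any two consecutive parts differ by at least $2$, and by at least $4$ if both are even. Let $GG_{-2}(n)$ denote the number of signed partitions of $n$ in which the positive parts are even and each at least $2(\ell^++1)$, and the negative parts are odd, distinct and each at most $2\ell^+$. Let $GG'_{-2}(n)$ denote the number of signed partitions of $n$ in which the positive parts are at least $4$, even and differ pairwise by at least $4$, and the negative parts are odd, distinct and each at most $2\ell^+-1$. Here $\ell^+$ is the number of positive parts of the signed partition. Then $GG_2(n)=GG_{-2}(n)=GG'_{-2}(n)$ for all $n\ge 0$.
   Context: A partition of an integer $n$ is a finite nonincreasing sequence of positive integers (its parts) summing to $n$. A signed partition of an integer $n$ is a pair $(\pi,\nu)$ of ordinary partitions with $|\pi|-|\nu|=n$, where $|\cdot|$ denotes the sum of parts; the parts of $\pi$ are the positive parts and the parts of $\nu$ are the negative parts (their sizes). $\ell^+$ denotes the number of positive parts of a signed partition. *)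

theory Defs imports Main begin

definition is_partition :: "nat list \<Rightarrow> bool" where
  "is_partition xs \<longleftrightarrow> sorted_wrt (\<ge>) xs \<and> (\<forall>x \<in> set xs. x > 0)"

definition partitions_of :: "nat \<Rightarrow> nat list set" where
  "partitions_of n = {xs. is_partition xs \<and> sum_list xs = n}"

definition signed_partitions_of :: "int \<Rightarrow> (nat list \<times> nat list) set" where
  "signed_partitions_of n =
     {(\<pi>, \<nu>). is_partition \<pi> \<and> is_partition \<nu> \<and> int (sum_list \<pi>) - int (sum_list \<nu>) = n}"

definition GG2_set :: "nat \<Rightarrow> nat list set" where
  "GG2_set n =
     {xs \<in> partitions_of n.
        (\<forall>x \<in> set xs. x \<ge> 3) \<and>
        (\<forall>i. Suc i < length xs \<longrightarrow>
           xs ! i \<ge> xs ! Suc i + 2 \<and>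
           (even (xs ! i) \<and> even (xs ! Suc i) \<longrightarrow> xs ! i \<ge> xs ! Suc i + 4))}"

definition GGm2_set :: "int \<Rightarrow> (nat list \<times> nat list) set" where
  "GGm2_set n =
     {(\<pi>, \<nu>) \<in> signed_partitions_of n.
        (\<forall>x \<in> set \<pi>. even x \<and> x \<ge> 2 * (length \<pi> + 1)) \<and>
        distinct \<nu> \<and> (\<forall>y \<in> set \<nu>. odd y \<and> y \<le> 2 * length \<pi>)}"

definition GGm2'_set :: "int \<Rightarrow> (nat list \<times> nat list) set" where
  "GGm2'_set n =
     {(\<pi>, \<nu>) \<in> signed_partitions_of n.
        (\<forall>x \<in> set \<pi>. even x \<and> x \<ge> 4) \<and>
        (\<forall>i j. i < j \<and> j < length \<pi> \<longrightarrow> \<pi> ! i \<ge> \<pi> ! j + 4) \<and>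
        distinct \<nu> \<and> (\<forall>y \<in> set \<nu>. odd y \<and> int y \<le> 2 * int (length \<pi>) - 1)}"

definition GG2 :: "nat \<Rightarrow> nat" where
  "GG2 n = card (GG2_set n)"

definition GGm2 :: "int \<Rightarrow> nat" where
  "GGm2 n = card (GGm2_set n)"

definition GGm2' :: "int \<Rightarrow> nat" where
  "GGm2' n = card (GGm2'_set n)"

text \<open>
  An integer has infinitely many signed partitions, so it is not immediate that the sets above are
  finite, i.e. that \<^const>\<open>card\<close> (which is 0 on infinite sets) really counts their elements.
\<close>

lemma length_le_sum_list_pos:
  fixes xs :: "nat list"
  shows "\<forall>x \<in> set xs. x > 0 \<Longrightarrow> length xs \<le> sum_list xs"
  by (induction xs) auto

lemma finite_partitions_le: "finite {xs. is_partition xs \<and> sum_list xs \<le> N}"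
proof (rule finite_subset)
  show "{xs. is_partition xs \<and> sum_list xs \<le> N} \<subseteq> {xs. set xs \<subseteq> {..N} \<and> length xs \<le> N}"
    by (auto simp: is_partition_def dest: length_le_sum_list_pos member_le_sum_list)
  show "finite {xs. set xs \<subseteq> {..N} \<and> length xs \<le> N}"
    by (rule finite_lists_length_le) simp
qed

lemma sum_list_distinct_odd_le:
  fixes ys :: "nat list"
  assumes "distinct ys" "\<forall>y \<in> set ys. odd y \<and> y \<le> 2 * l"
  shows "sum_list ys \<le> l * l"
proof -
  have sub: "set ys \<subseteq> (\<lambda>i. 2 * i + 1) ` {..<l}"
  proof
    fix y assume "y \<in> set ys"
    with assms have "odd y" "y \<le> 2 * l" by auto
    then obtain i where i: "y = 2 * i + 1" by (auto elim: oddE)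
    then have "i < l" using \<open>y \<le> 2 * l\<close> by auto
    then show "y \<in> (\<lambda>i. 2 * i + 1) ` {..<l}" using i by auto
  qed
  have "sum_list ys = \<Sum> (set ys)"
    using assms(1) by (simp add: distinct_sum_list_conv_Sum)
  also have "\<dots> \<le> \<Sum> ((\<lambda>i. 2 * i + 1) ` {..<l})"
    by (rule sum_mono2) (use sub in auto)
  also have "\<dots> = (\<Sum>i<l. 2 * i + 1)"
    by (subst sum.reindex) (auto simp: inj_on_def)
  also have "\<dots> = l * l" by (induction l) auto
  finally show ?thesis .
qed

lemma sum_list_gap4_ge:
  fixes xs :: "nat list"
  shows "sorted_wrt (\<lambda>a b. a \<ge> b + 4) xs \<Longrightarrow> \<forall>x \<in> set xs. x \<ge> 4 \<Longrightarrow>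
    (xs \<noteq> [] \<longrightarrow> hd xs \<ge> 4 * length xs) \<and> sum_list xs \<ge> 2 * (length xs * (length xs + 1))"
proof (induction xs)
  case Nil
  then show ?case by simp
next
  case (Cons a xs)
  then have IH: "xs \<noteq> [] \<longrightarrow> hd xs \<ge> 4 * length xs"
      "sum_list xs \<ge> 2 * (length xs * (length xs + 1))" by auto
  have "a \<ge> 4 * (length xs + 1)"
    using Cons.prems IH(1) by (cases xs) auto
  then show ?case using IH(2) by auto
qed

lemma finite_signed_bounded:
  assumes "S \<subseteq> signed_partitions_of n"
    and "\<And>\<pi> \<nu>. (\<pi>, \<nu>) \<in> S \<Longrightarrow> sum_list \<pi> \<ge> 2 * (length \<pi> * (length \<pi> + 1))"
    and "\<And>\<pi> \<nu>. (\<pi>, \<nu>) \<in> S \<Longrightarrow> sum_list \<nu> \<le> length \<pi> * length \<pi>"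
  shows "finite S"
proof -
  define N where "N = nat n + nat n * nat n"
  let ?P = "{xs. is_partition xs \<and> sum_list xs \<le> N}"
  have "S \<subseteq> ?P \<times> ?P"
  proof (rule subrelI)
    fix \<pi> \<nu> assume mem: "(\<pi>, \<nu>) \<in> S"
    then have sp: "is_partition \<pi>" "is_partition \<nu>"
        "int (sum_list \<pi>) - int (sum_list \<nu>) = n"
      using assms(1) by (auto simp: signed_partitions_of_def)
    note b = assms(2,3)[OF mem]
    have eq: "int (sum_list \<pi>) = n + int (sum_list \<nu>)" using sp(3) by simp
    have "sum_list \<pi> \<ge> 2 * (length \<pi> * length \<pi>) + 2 * length \<pi>"
      using b(1) by (simp add: algebra_simps)
    then have "n \<ge> int (length \<pi> * length \<pi> + 2 * length \<pi>)"
      using b(2) eq by linarith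
    then have l: "length \<pi> \<le> nat n" by linarith
    then have "length \<pi> * length \<pi> \<le> nat n * nat n" by (simp add: mult_le_mono)
    then have \<nu>: "sum_list \<nu> \<le> nat n * nat n" using b by linarith
    then have "sum_list \<nu> \<le> N" by (simp add: N_def)
    moreover have "sum_list \<pi> \<le> N" using eq \<nu> unfolding N_def by linarith
    ultimately show "(\<pi>, \<nu>) \<in> ?P \<times> ?P" using sp by simp
  qed
  then show ?thesis
    by (rule finite_subset) (simp add: finite_partitions_le)
qed

lemma finite_GG2_set: "finite (GG2_set n)"
  by (rule finite_subset[OF _ finite_partitions_le[of n]])
     (auto simp: GG2_set_def partitions_of_def)

lemma finite_GGm2_set: "finite (GGm2_set n)"
proof (rule finite_signed_bounded)
  show "GGm2_set n \<subseteq> signed_partitions_of n" by (auto simp: GGm2_set_def)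
next
  fix \<pi> \<nu> assume mem: "(\<pi>, \<nu>) \<in> GGm2_set n"
  have "sum_list (map (\<lambda>_. 2 * (length \<pi> + 1)) \<pi>) \<le> sum_list (map (\<lambda>x. x) \<pi>)"
    by (rule sum_list_mono) (use mem in \<open>auto simp: GGm2_set_def\<close>)
  then show "sum_list \<pi> \<ge> 2 * (length \<pi> * (length \<pi> + 1))"
    by (simp add: sum_list_triv algebra_simps)
  show "sum_list \<nu> \<le> length \<pi> * length \<pi>"
    by (rule sum_list_distinct_odd_le) (use mem in \<open>auto simp: GGm2_set_def\<close>)
qed

lemma finite_GGm2'_set: "finite (GGm2'_set n)"
proof (rule finite_signed_bounded)
  show "GGm2'_set n \<subseteq> signed_partitions_of n" by (auto simp: GGm2'_set_def)
next
  fix \<pi> \<nu> assume mem: "(\<pi>, \<nu>) \<in> GGm2'_set n"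
  have "sorted_wrt (\<lambda>a b. a \<ge> b + 4) \<pi>" "\<forall>x \<in> set \<pi>. x \<ge> 4"
    using mem by (auto simp: GGm2'_set_def sorted_wrt_iff_nth_less)
  then show "sum_list \<pi> \<ge> 2 * (length \<pi> * (length \<pi> + 1))"
    using sum_list_gap4_ge by blast
  show "sum_list \<nu> \<le> length \<pi> * length \<pi>"
    by (rule sum_list_distinct_odd_le) (use mem in \<open>force simp: GGm2'_set_def\<close>)+
qed

end

theory Submission imports Defs begin

text \<open>
  Index the parts of a partition decreasingly from \<open>0\<close>. For \<open>GG2 = GGm2'\<close>, let a negative part
  \<open>2 * j + 1\<close> of a signed partition lower each of the \<open>j\<close> largest positive parts by \<open>2\<close> and the part
  of index \<open>j\<close> by \<open>1\<close>. Since the positive parts are even, the indices of the odd parts of the result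
  reveal the negative parts, so the process can be undone; the gap between two neighbouring parts
  drops by \<open>1\<close> for each of the two that becomes odd, which turns the even gaps of size at least
  \<open>4\<close> into exactly the gaps allowed in \<open>GG2\<close>. For \<open>GGm2 = GGm2'\<close>, removing \<open>2 * (l + 1)\<close> from
  each of \<open>l\<close> parts, or the staircase \<open>4 * l, \<dots>, 8, 4\<close>, which has the same sum, leaves an
  arbitrary decreasing sequence of even numbers.
\<close>

section \<open>The three sets in terms of gaps and admissible negative parts\<close>

text \<open>One predicate serves both signed families, since an odd \<open>y\<close> satisfies
  \<open>y \<le> 2 * l\<close> exactly when it is at most \<open>2 * l - 1\<close>.\<close>

definition neg_parts :: "nat \<Rightarrow> nat list \<Rightarrow> bool" where
  "neg_parts l ys \<longleftrightarrow> sorted_wrt (>) ys \<and> (\<forall>y \<in> set ys. odd y \<and> y \<le> 2 * l)"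

lemma sorted_wrt_greater_iff_distinct:
  fixes ys :: "nat list"
  shows "sorted_wrt (>) ys \<longleftrightarrow> sorted_wrt (\<ge>) ys \<and> distinct ys"
  by (induction ys) (auto simp: order.strict_iff_order)

lemma neg_parts_iff:
  "neg_parts l ys \<longleftrightarrow>
     is_partition ys \<and> distinct ys \<and> (\<forall>y \<in> set ys. odd y \<and> y \<le> 2 * l)"
  by (auto simp: neg_parts_def is_partition_def sorted_wrt_greater_iff_distinct intro: odd_pos)

definition gg_gap :: "nat \<Rightarrow> nat \<Rightarrow> bool" where
  "gg_gap x y \<longleftrightarrow> y + 2 \<le> x \<and> (even x \<and> even y \<longrightarrow> y + 4 \<le> x)"

lemma is_partition_if_gg_gap:
  assumes "successively gg_gap xs" "\<forall>x \<in> set xs. 3 \<le> x"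
  shows "is_partition xs"
proof -
  have "successively (\<ge>) xs"
    by (rule successively_mono[OF assms(1)]) (auto simp: gg_gap_def)
  then have "sorted_wrt (\<ge>) xs"
    by (subst (asm) successively_conv_sorted_wrt) (auto intro: transpI)
  then show ?thesis
    using assms(2) by (fastforce simp: is_partition_def)
qed

text \<open>The gaps already force a decreasing order, so conditions on adjacent parts and on size
  suffice; this form suits induction over the list.\<close>

lemma GG2_set_eq:
  "GG2_set n =
     {xs. successively gg_gap xs \<and> (\<forall>x \<in> set xs. 3 \<le> x) \<and> sum_list xs = n}"
proof (intro equalityI subsetI)
  fix xs assume "xs \<in> GG2_set n"
  then show "xs \<in> {xs. successively gg_gap xs \<and> (\<forall>x \<in> set xs. 3 \<le> x) \<and> sum_list xs = n}"
    by (simp add: GG2_set_def partitions_of_def successively_conv_nth gg_gap_def)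
next
  fix xs assume "xs \<in> {xs. successively gg_gap xs \<and> (\<forall>x \<in> set xs. 3 \<le> x) \<and> sum_list xs = n}"
  then show "xs \<in> GG2_set n"
    using is_partition_if_gg_gap[of xs]
    by (simp add: GG2_set_def partitions_of_def successively_conv_nth gg_gap_def)
qed

lemma is_partition_if_gap4:
  assumes "sorted_wrt (\<lambda>x y. y + 4 \<le> x) xs" "\<forall>x \<in> set xs. even x \<and> 4 \<le> x"
  shows "is_partition xs"
proof -
  have "sorted_wrt (\<ge>) xs"
    by (rule sorted_wrt_mono_rel[OF _ assms(1)]) auto
  then show ?thesis
    using assms(2) by (fastforce simp: is_partition_def)
qed

lemma GGm2'_set_eq:
  "GGm2'_set n =
     {(\<pi>, \<nu>). sorted_wrt (\<lambda>x y. y + 4 \<le> x) \<pi> \<and> (\<forall>x \<in> set \<pi>. even x \<and> 4 \<le> x) \<and>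
        neg_parts (length \<pi>) \<nu> \<and> int (sum_list \<pi>) - int (sum_list \<nu>) = n}"
proof -
  have bound: "(odd y \<and> int y \<le> 2 * int l - 1) = (odd y \<and> y \<le> 2 * l)" for y l :: nat
    by presburger
  have "(\<pi>, \<nu>) \<in> GGm2'_set n \<longleftrightarrow>
      sorted_wrt (\<lambda>x y. y + 4 \<le> x) \<pi> \<and> (\<forall>x \<in> set \<pi>. even x \<and> 4 \<le> x) \<and>
      neg_parts (length \<pi>) \<nu> \<and> int (sum_list \<pi>) - int (sum_list \<nu>) = n" for \<pi> \<nu>
    using is_partition_if_gap4[of \<pi>]
    unfolding GGm2'_set_def signed_partitions_of_def bound neg_parts_iff
      sorted_wrt_iff_nth_less[of "\<lambda>x y. y + 4 \<le> x"] mem_Collect_eq prod.case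
    by blast
  then show ?thesis by auto
qed

lemma GGm2_set_eq:
  "GGm2_set n =
     {(\<pi>, \<nu>). sorted_wrt (\<ge>) \<pi> \<and> (\<forall>x \<in> set \<pi>. even x \<and> 2 * (length \<pi> + 1) \<le> x) \<and>
        neg_parts (length \<pi>) \<nu> \<and> int (sum_list \<pi>) - int (sum_list \<nu>) = n}"
proof -
  have pos: "\<forall>x \<in> set \<pi>. 0 < x" if "\<forall>x \<in> set \<pi>. even x \<and> 2 * (length \<pi> + 1) \<le> x"
    for \<pi> :: "nat list"
    using that by fastforce
  have "(\<pi>, \<nu>) \<in> GGm2_set n \<longleftrightarrow>
      sorted_wrt (\<ge>) \<pi> \<and> (\<forall>x \<in> set \<pi>. even x \<and> 2 * (length \<pi> + 1) \<le> x) \<and>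
      neg_parts (length \<pi>) \<nu> \<and> int (sum_list \<pi>) - int (sum_list \<nu>) = n" for \<pi> \<nu>
    using pos[of \<pi>]
    unfolding GGm2_set_def signed_partitions_of_def neg_parts_iff is_partition_def
      mem_Collect_eq prod.case
    by blast
  then show ?thesis by auto
qed

subsection \<open>Partitions and signed partitions with gaps\<close>

text \<open>The index \<open>j\<close> of an odd part is recorded as \<open>2 * j + 1\<close>.\<close>
fun odd_indices :: "nat list \<Rightarrow> nat list" where
  "odd_indices [] = []"
| "odd_indices (x # xs) = map (\<lambda>y. y + 2) (odd_indices xs) @ (if odd x then [1] else [])"

text \<open>Undoes the lowering: each odd part further down gives 2 back to \<open>x\<close>, and an
  odd \<open>x\<close> itself regains 1.\<close>

fun even_lift :: "nat list \<Rightarrow> nat list" where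
  "even_lift [] = []"
| "even_lift (x # xs) = (x + 2 * length (odd_indices xs) + x mod 2) # even_lift xs"

lemma length_even_lift [simp]: "length (even_lift xs) = length xs"
  by (induction xs) auto

lemma sum_list_map_add_const:
  fixes c :: nat
  shows "sum_list (map (\<lambda>y. y + c) ys) = sum_list ys + c * length ys"
  by (induction ys) auto

text \<open>An odd part of index \<open>j\<close> adds 2 to each of the \<open>j\<close> parts
  before it and 1 to itself, in total the recorded \<open>2 * j + 1\<close>.\<close>

lemma sum_list_even_lift:
  "sum_list (even_lift xs) = sum_list xs + sum_list (odd_indices xs)"
  by (induction xs)
     (auto simp: sum_list_map_add_const odd_iff_mod_2_eq_one simp del: add_2_eq_Suc')

text \<open>A new first part raises every index by one, hence every entry by 2, and leaves the value
  1 to record its own parity.\<close>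

lemma neg_parts_Cons:
  "neg_parts (Suc l) (map (\<lambda>y. y + 2) ys @ (if b then [1] else [])) \<longleftrightarrow> neg_parts l ys"
  by (auto simp: neg_parts_def sorted_wrt_append sorted_wrt_map)

lemma neg_parts_SucE:
  assumes "neg_parts (Suc l) ys"
  obtains zs b where "ys = map (\<lambda>y. y + 2) zs @ (if b then [1] else [])" "neg_parts l zs"
proof -
  have shift: "map (\<lambda>y. y + 2) (map (\<lambda>y. y - 2) zs) = zs" if "\<forall>z \<in> set zs. 2 \<le> z"
    for zs :: "nat list"
    using that by (induction zs) auto
  have "\<exists>zs b. ys = map (\<lambda>y. y + 2) zs @ (if b then [1] else [])"
  proof (cases ys rule: rev_cases)
    case Nil
    then show ?thesis by (intro exI[of _ "[]"] exI[of _ False]) simp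
  next
    case (snoc us u)
    have u: "odd u" "\<forall>v \<in> set us. u < v"
      using assms snoc by (auto simp: neg_parts_def sorted_wrt_append)
    show ?thesis
    proof (cases "u = 1")
      case True
      then have "map (\<lambda>y. y + 2) (map (\<lambda>y. y - 2) us) = us"
        using u by (intro shift) auto
      then show ?thesis
        using snoc True by (intro exI[of _ "map (\<lambda>y. y - 2) us"] exI[of _ True]) simp
    next
      case False
      have "2 \<le> u"
        using u(1) False by presburger
      \<comment> \<open>The last entry \<open>u\<close> is the least one, so no entry is 1 and
        subtracting 2 is not truncated.\<close>
      then have "\<forall>y \<in> set ys. 2 \<le> y"
        using u(2) snoc by auto
      then have "map (\<lambda>y. y + 2) (map (\<lambda>y. y - 2) ys) = ys"
        by (rule shift)
      then show ?thesis
        by (intro exI[of _ "map (\<lambda>y. y - 2) ys"] exI[of _ False]) simp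
    qed
  qed
  then show ?thesis
    using assms that neg_parts_Cons by metis
qed

lemma neg_parts_odd_indices: "neg_parts (length xs) (odd_indices xs)"
proof (induction xs)
  case Nil
  then show ?case by (simp add: neg_parts_def)
next
  case (Cons x xs)
  then show ?case
    using neg_parts_Cons[of "length xs" "odd_indices xs" "odd x"] by simp
qed

text \<open>Shifted entries are at least 2, so a final 1 can only come from the flag.\<close>

lemma map_add_2_append_eq_iff:
  fixes ys zs :: "nat list"
  shows "map (\<lambda>y. y + 2) ys @ (if b then [1] else []) =
           map (\<lambda>y. y + 2) zs @ (if c then [1] else []) \<longleftrightarrow> ys = zs \<and> b = c"
proof -
  have "inj (\<lambda>y::nat. y + 2)" by (simp add: inj_def)
  moreover have "map (\<lambda>y. y + 2) us \<noteq> map (\<lambda>y. y + 2) vs @ [1]" for us vs :: "nat list"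
  proof
    assume "map (\<lambda>y. y + 2) us = map (\<lambda>y. y + 2) vs @ [1]"
    then have "1 \<in> set (map (\<lambda>y. y + 2) us)" by simp
    then show False by auto
  qed
  ultimately show ?thesis
    by (auto simp: inj_map_eq_map) metis
qed

text \<open>The indices give the parity of the head and the number of odd parts behind it; the
  lifted head then determines \<open>x\<close>.\<close>

lemma even_lift_odd_indices_inject:
  "even_lift xs = even_lift ys \<Longrightarrow> odd_indices xs = odd_indices ys \<Longrightarrow> xs = ys"
proof (induction xs arbitrary: ys)
  case Nil
  then show ?case by (cases ys) auto
next
  case (Cons x xs)
  then obtain y zs where ys: "ys = y # zs" by (cases ys) auto
  have "odd_indices xs = odd_indices zs" and par: "odd x = odd y"
    using Cons.prems(2) unfolding ys odd_indices.simps map_add_2_append_eq_iff by auto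
  then have "xs = zs" and "x + x mod 2 = y + y mod 2"
    using Cons.IH[of zs] Cons.prems(1) by (auto simp: ys)
  then show ?case
    using par ys
    by (cases "even x") (auto simp: odd_iff_mod_2_eq_one even_iff_mod_2_eq_zero)
qed

text \<open>
  With \<open>m\<close> the number of odd parts after \<open>y\<close>, this compares the gap between the parts \<open>x\<close> and
  \<open>y\<close> with the gap between their lifts.
\<close>
lemma gg_gap_iff_lift:
  "gg_gap x y \<longleftrightarrow>
     (y + 2 * m + y mod 2) + 4 \<le> x + 2 * (m + y mod 2) + x mod 2"
  unfolding gg_gap_def
  by (cases "even x"; cases "even y") (auto elim!: evenE oddE simp: mod_Suc, presburger+)

lemma length_odd_indices_Cons:
  "length (odd_indices (x # xs)) = length (odd_indices xs) + x mod 2"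
  by (auto simp: odd_iff_mod_2_eq_one)

lemma successively_gap4_even_lift:
  "successively (\<lambda>x y. y + 4 \<le> x) (even_lift xs) \<longleftrightarrow> successively gg_gap xs"
proof (induction xs)
  case (Cons x xs)
  show ?case
  proof (cases xs)
    case (Cons y ys)
    then show ?thesis
      using Cons.IH gg_gap_iff_lift[of x y "length (odd_indices ys)"]
      by (simp add: length_odd_indices_Cons del: odd_indices.simps)
  qed simp
qed simp

text \<open>A gap of at least 4 is a transitive relation, so adjacent pairs decide all
  pairs.\<close>

lemma sorted_wrt_gap4_even_lift:
  "sorted_wrt (\<lambda>x y. y + 4 \<le> x) (even_lift xs) \<longleftrightarrow> successively gg_gap xs"
  unfolding successively_gap4_even_lift[symmetric]
  by (rule successively_conv_sorted_wrt[symmetric]) (auto intro: transpI)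

lemma even_lift_even_ge_4:
  "\<forall>x \<in> set xs. 3 \<le> x \<Longrightarrow> \<forall>x \<in> set (even_lift xs). even x \<and> 4 \<le> x"
proof (induction xs)
  case (Cons x xs)
  have "even (x + 2 * m + x mod 2) \<and> 4 \<le> x + 2 * m + x mod 2" for m
  proof -
    have "3 \<le> x" using Cons.prems by simp
    then show ?thesis
      by (cases "even x") (auto elim!: evenE oddE simp: mod_Suc, presburger)
  qed
  then show ?case
    using Cons by simp
qed simp

text \<open>The preimage is built from the smallest part upwards: the head is \<open>p\<close>
  lowered by 2 for each odd part of the tail, and by 1 more if 1 is a negative part.\<close>

lemma even_lift_surj:
  assumes "sorted_wrt (\<lambda>x y. y + 4 \<le> x) \<pi>" "\<forall>x \<in> set \<pi>. even x \<and> 4 \<le> x"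
    and "neg_parts (length \<pi>) \<nu>"
  shows "\<exists>xs. even_lift xs = \<pi> \<and> odd_indices xs = \<nu> \<and> (\<forall>x \<in> set xs. 3 \<le> x)"
  using assms
proof (induction \<pi> arbitrary: \<nu>)
  case Nil
  then have "\<nu> = []" by (cases \<nu>) (auto simp: neg_parts_def)
  then show ?case by (intro exI[of _ "[]"]) simp
next
  case (Cons p \<pi>)
  obtain \<nu>' b where \<nu>: "\<nu> = map (\<lambda>y. y + 2) \<nu>' @ (if b then [1] else [])"
    and \<nu>': "neg_parts (length \<pi>) \<nu>'"
    using neg_parts_SucE[of "length \<pi>" \<nu>] Cons.prems(3) by auto
  obtain xs where xs: "even_lift xs = \<pi>" "odd_indices xs = \<nu>'" "\<forall>x \<in> set xs. 3 \<le> x"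
    using Cons.IH[OF _ _ \<nu>'] Cons.prems by auto
  have p: "even p" "4 \<le> p" using Cons.prems(2) by auto
  \<comment> \<open>Room for the lowering: the head keeps at least 4 before a possible further loss
    of 1, so it ends at 3 or more.\<close>
  have m: "2 * length \<nu>' + 4 \<le> p"
  proof (cases xs)
    case Nil
    then show ?thesis using xs(2) p by simp
  next
    case (Cons y ys)
    then have "length \<nu>' = length (odd_indices ys) + y mod 2"
      using xs(2) length_odd_indices_Cons by metis
    moreover have "y + 2 * length (odd_indices ys) + y mod 2 \<in> set \<pi>"
      using xs(1) Cons by auto
    then have "y + 2 * length (odd_indices ys) + y mod 2 + 4 \<le> p"
      using Cons.prems(1) by simp
    moreover have "3 \<le> y" using xs(3) Cons by simp
    ultimately show ?thesis
      by linarith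
  qed
  obtain k where k: "p = 2 * length \<nu>' + 2 * Suc (Suc k)"
  proof -
    have "even (p - (2 * length \<nu>' + 4))"
      using p(1) m by simp
    then obtain k where "p - (2 * length \<nu>' + 4) = 2 * k" by (rule evenE)
    then show ?thesis using m that[of k] by simp
  qed
  define x where "x = (if b then 2 * k + 3 else 2 * k + 4)"
  have "odd x \<longleftrightarrow> b" "3 \<le> x" "x + 2 * length \<nu>' + x mod 2 = p"
    unfolding x_def k by (auto simp: numeral_3_eq_3 mod_Suc)
  then show ?case
    using xs \<nu> by (intro exI[of _ "x # xs"]) auto
qed

lemma bij_betw_GG2_GGm2':
  "bij_betw (\<lambda>xs. (even_lift xs, odd_indices xs)) (GG2_set n) (GGm2'_set (int n))"
  unfolding bij_betw_def
proof
  show "inj_on (\<lambda>xs. (even_lift xs, odd_indices xs)) (GG2_set n)"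
    by (auto intro!: inj_onI even_lift_odd_indices_inject)
  show "(\<lambda>xs. (even_lift xs, odd_indices xs)) ` GG2_set n = GGm2'_set (int n)"
  proof (intro equalityI subsetI)
    fix z assume "z \<in> (\<lambda>xs. (even_lift xs, odd_indices xs)) ` GG2_set n"
    then obtain xs where "z = (even_lift xs, odd_indices xs)" "xs \<in> GG2_set n" by auto
    then show "z \<in> GGm2'_set (int n)"
      using even_lift_even_ge_4[of xs]
      by (simp add: GG2_set_eq GGm2'_set_eq sorted_wrt_gap4_even_lift neg_parts_odd_indices
          sum_list_even_lift)
  next
    fix z assume "z \<in> GGm2'_set (int n)"
    moreover obtain \<pi> \<nu> where z: "z = (\<pi>, \<nu>)" by (cases z)
    ultimately have mem: "sorted_wrt (\<lambda>x y. y + 4 \<le> x) \<pi>" "\<forall>x \<in> set \<pi>. even x \<and> 4 \<le> x"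
      "neg_parts (length \<pi>) \<nu>" "int (sum_list \<pi>) - int (sum_list \<nu>) = int n"
      by (auto simp: GGm2'_set_eq)
    obtain xs where xs: "even_lift xs = \<pi>" "odd_indices xs = \<nu>" "\<forall>x \<in> set xs. 3 \<le> x"
      using even_lift_surj[OF mem(1-3)] by blast
    have "xs \<in> GG2_set n"
      using mem(1,4) xs sum_list_even_lift[of xs] sorted_wrt_gap4_even_lift[of xs]
      by (simp add: GG2_set_eq)
    then show "z \<in> (\<lambda>xs. (even_lift xs, odd_indices xs)) ` GG2_set n"
      using xs z by auto
  qed
qed

subsection \<open>Removing the staircase\<close>

fun add_staircase :: "nat list \<Rightarrow> nat list" where
  "add_staircase [] = []"
| "add_staircase (x # xs) = (x + 4 * (length xs + 1)) # add_staircase xs"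

lemma length_add_staircase [simp]: "length (add_staircase xs) = length xs"
  by (induction xs) auto

text \<open>The total \<open>4 + 8 + \<dots> + 4 * l\<close> equals \<open>l\<close> copies of
  \<open>2 * (l + 1)\<close>, which is why both signed families reduce to the same set.\<close>

lemma sum_list_add_staircase:
  "sum_list (add_staircase xs) = sum_list xs + 2 * (length xs + 1) * length xs"
  by (induction xs) (auto simp: algebra_simps)

lemma add_staircase_inject: "add_staircase xs = add_staircase ys \<Longrightarrow> xs = ys"
proof (induction xs arbitrary: ys)
  case Nil
  then show ?case by (cases ys) auto
next
  case (Cons x xs)
  then obtain y zs where ys: "ys = y # zs" by (cases ys) auto
  then show ?case using Cons.IH[of zs] Cons.prems by auto
qed

lemma successively_gap4_add_staircase:
  "successively (\<lambda>x y. y + 4 \<le> x) (add_staircase xs) \<longleftrightarrow> successively (\<ge>) xs"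
proof (induction xs)
  case (Cons x xs)
  then show ?case by (cases xs) auto
qed simp

lemma sorted_wrt_gap4_add_staircase:
  "sorted_wrt (\<lambda>x y. y + 4 \<le> x) (add_staircase xs) \<longleftrightarrow> sorted_wrt (\<ge>) xs"
proof -
  have "transp (\<lambda>x y::nat. y + 4 \<le> x)" "transp ((\<ge>) :: nat \<Rightarrow> nat \<Rightarrow> bool)"
    by (auto intro: transpI)
  then show ?thesis
    using successively_gap4_add_staircase[of xs] by (simp add: successively_conv_sorted_wrt)
qed

lemma add_staircase_even_ge_4:
  "(\<forall>x \<in> set (add_staircase xs). even x \<and> 4 \<le> x) \<longleftrightarrow> (\<forall>x \<in> set xs. even x)"
  by (induction xs) auto

lemma add_staircase_surj:
  assumes "sorted_wrt (\<lambda>x y. y + 4 \<le> x) \<pi>" "\<forall>x \<in> set \<pi>. 4 \<le> x"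
  shows "\<exists>xs. add_staircase xs = \<pi>"
  using assms
proof (induction \<pi>)
  case Nil
  then show ?case by (intro exI[of _ "[]"]) simp
next
  case (Cons p \<pi>)
  then obtain xs where xs: "add_staircase xs = \<pi>" by auto
  \<comment> \<open>Gaps of 4 above a least part of at least 4 make the head large enough for an
    untruncated subtraction.\<close>
  have "4 * (length xs + 1) \<le> p"
    using sum_list_gap4_ge[of "p # \<pi>"] Cons.prems xs by auto
  then show ?case
    using xs by (intro exI[of _ "(p - 4 * (length xs + 1)) # xs"]) auto
qed

text \<open>Zeros are allowed in \<open>\<alpha>\<close>, so its length still records the number of
  positive parts.\<close>

definition reduced_set :: "int \<Rightarrow> (nat list \<times> nat list) set" where
  "reduced_set n =
     {(\<alpha>, \<nu>). sorted_wrt (\<ge>) \<alpha> \<and> (\<forall>x \<in> set \<alpha>. even x) \<and> neg_parts (length \<alpha>) \<nu> \<and>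
        int (sum_list \<alpha> + 2 * (length \<alpha> + 1) * length \<alpha>) - int (sum_list \<nu>) = n}"

text \<open>Both reductions change only the positive parts and leave the negative parts
  alone.\<close>

lemma bij_betw_map_prod_id:
  assumes inj: "\<And>x y. f x = f y \<Longrightarrow> x = y"
    and mem: "\<And>x z. (f x, z) \<in> B \<longleftrightarrow> (x, z) \<in> A"
    and surj: "\<And>y z. (y, z) \<in> B \<Longrightarrow> \<exists>x. f x = y"
  shows "bij_betw (map_prod f id) A B"
  unfolding bij_betw_def
proof
  show "inj_on (map_prod f id) A"
    by (auto intro!: inj_onI dest: inj)
  have "w \<in> map_prod f id ` A" if "w \<in> B" for w
  proof -
    obtain y z where w: "w = (y, z)" by (cases w)
    then obtain x where "f x = y" using surj \<open>w \<in> B\<close> by blast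
    then have "(x, z) \<in> A" "w = map_prod f id (x, z)"
      using mem \<open>w \<in> B\<close> w by auto
    then show ?thesis by (rule rev_image_eqI)
  qed
  then show "map_prod f id ` A = B"
    using mem by auto
qed

lemma bij_betw_reduced_GGm2':
  "bij_betw (map_prod add_staircase id) (reduced_set n) (GGm2'_set n)"
proof (rule bij_betw_map_prod_id)
  show "\<alpha> = \<beta>" if "add_staircase \<alpha> = add_staircase \<beta>" for \<alpha> \<beta>
    using that by (rule add_staircase_inject)
  show "(add_staircase \<alpha>, \<nu>) \<in> GGm2'_set n \<longleftrightarrow> (\<alpha>, \<nu>) \<in> reduced_set n" for \<alpha> \<nu>
    by (simp add: reduced_set_def GGm2'_set_eq sorted_wrt_gap4_add_staircase
        add_staircase_even_ge_4 sum_list_add_staircase)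
  show "\<exists>\<alpha>. add_staircase \<alpha> = \<pi>" if "(\<pi>, \<nu>) \<in> GGm2'_set n" for \<pi> \<nu>
    using that add_staircase_surj[of \<pi>] by (auto simp: GGm2'_set_eq)
qed

section \<open>Raising all parts by the same amount\<close>

definition raise_parts :: "nat list \<Rightarrow> nat list" where
  "raise_parts xs = map (\<lambda>x. x + 2 * (length xs + 1)) xs"

lemma length_raise_parts [simp]: "length (raise_parts xs) = length xs"
  by (simp add: raise_parts_def)

lemma raise_parts_inject:
  assumes "raise_parts xs = raise_parts ys"
  shows "xs = ys"
proof -
  \<comment> \<open>The amount added depends on the length, so the lengths are compared
    first.\<close>
  have "length xs = length ys"
    using assms length_raise_parts by metis
  moreover have "inj (\<lambda>x::nat. x + c)" for c by (simp add: inj_def)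
  ultimately show ?thesis
    using assms by (simp add: raise_parts_def inj_map_eq_map del: add_Suc_right)
qed

lemma raise_parts_surj:
  assumes "\<forall>x \<in> set \<pi>. 2 * (length \<pi> + 1) \<le> x"
  shows "\<exists>xs. raise_parts xs = \<pi>"
  using assms
  by (intro exI[of _ "map (\<lambda>x. x - 2 * (length \<pi> + 1)) \<pi>"])
     (auto simp: raise_parts_def intro!: map_idI)

lemma bij_betw_reduced_GGm2:
  "bij_betw (map_prod raise_parts id) (reduced_set n) (GGm2_set n)"
proof (rule bij_betw_map_prod_id)
  have sum: "sum_list (raise_parts \<alpha>) = sum_list \<alpha> + 2 * (length \<alpha> + 1) * length \<alpha>" for \<alpha>
    unfolding raise_parts_def by (rule sum_list_map_add_const)
  have sorted: "sorted_wrt (\<ge>) (raise_parts \<alpha>) \<longleftrightarrow> sorted_wrt (\<ge>) \<alpha>" for \<alpha>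
    by (simp add: raise_parts_def sorted_wrt_map)
  have even: "(\<forall>x \<in> set (raise_parts \<alpha>). even x \<and> 2 * (length \<alpha> + 1) \<le> x) \<longleftrightarrow>
      (\<forall>x \<in> set \<alpha>. even x)" for \<alpha>
    by (simp add: raise_parts_def)
  show "\<alpha> = \<beta>" if "raise_parts \<alpha> = raise_parts \<beta>" for \<alpha> \<beta>
    using that by (rule raise_parts_inject)
  show "(raise_parts \<alpha>, \<nu>) \<in> GGm2_set n \<longleftrightarrow> (\<alpha>, \<nu>) \<in> reduced_set n" for \<alpha> \<nu>
    unfolding reduced_set_def GGm2_set_eq mem_Collect_eq prod.case length_raise_parts
      sum sorted even ..
  show "\<exists>\<alpha>. raise_parts \<alpha> = \<pi>" if "(\<pi>, \<nu>) \<in> GGm2_set n" for \<pi> \<nu>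
    using that raise_parts_surj[of \<pi>] by (auto simp: GGm2_set_eq)
qed

theorem theorem4p3:
  fixes n :: nat
  shows "GG2 n = GGm2 (int n) \<and> GGm2 (int n) = GGm2' (int n)"
  using bij_betw_same_card[OF bij_betw_GG2_GGm2'[of n]]
    bij_betw_same_card[OF bij_betw_reduced_GGm2'[of "int n"]]
    bij_betw_same_card[OF bij_betw_reduced_GGm2[of "int n"]]
  by (simp add: GG2_def GGm2_def GGm2'_def)

end
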